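(* Let $N$ be a prime number, let $L_0 = \lfloor \sqrt{N} \rfloor$, and let $L$ be an integer with $L \ge L_0$. Then every binary matrix $X$ of size $N \times N$ is uniquely determined, among all $N\times N$ binary matrices, by its DFT coefficients $\tilde X_{kl}$ with $|k|\le L$ and $|l| \le L$. That is, if $X$ and $Y$ are $N\times N$ binary matrices such that $\tilde X_{kl} = \tilde Y_{kl}$ for all integers $k,l$ with $|k| \le L$ and $|l| \le L$, then $X = Y$.
   Context: A binary matrix is a matrix all of whose entries are $0$ or $1$. For an $N\times N$ matrix $X = (X_{mn})_{1\le m,n\le N}$ and integers $k,l$, the (two-dimensional) discrete Fourier transform (DFT) coefficient is $$\tilde X_{kl} = \sum_{m=1}^{N}\sum_{n=1}^{N} X_{mn}\, e^{2\pi \mathrm{i}\,(mk + nl)/N} \in \mathbb{C}.$$ The coefficients are $N$-periodic in each of the indices $k$ and $l$. *)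

theory Defs
  imports Complex_Main "Jordan_Normal_Form.Matrix"
begin

definition binary_mat :: "'a :: zero_neq_one mat \<Rightarrow> bool" where
  "binary_mat X \<longleftrightarrow> elements_mat X \<subseteq> {0, 1}"

text \<open>
  Entries of type \<open>mat\<close> are indexed from 0, so the entry in row \<open>m\<close> and column \<open>n\<close>,
  counted from 1 as in the phase factor, is \<open>X $$ (m - 1, n - 1)\<close>.
\<close>

definition dft2 :: "nat \<Rightarrow> complex mat \<Rightarrow> int \<Rightarrow> int \<Rightarrow> complex" where
  "dft2 N X k l = (\<Sum>m = 1..N. \<Sum>n = 1..N.
     X $$ (m - 1, n - 1) *
     exp (2 * of_real pi * \<i> * of_int (int m * k + int n * l) / of_nat N))"

end

theory Submission
  imports Defs "HOL-Number_Theory.Cong" "Jordan_Normal_Form.Char_Poly"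
begin

text \<open>
  Let \<open>d = X - Y\<close>, an integer matrix all of whose coefficients in the box
  \<open>\<bar>k\<bar>, \<bar>l\<bar> \<le> L\<close> vanish. Collecting the entries of \<open>d\<close> according to the residue of
  \<open>m k + n l\<close> modulo \<open>N\<close>, the coefficient at \<open>(k, l)\<close> becomes an integer combination
  \<open>\<Sum>j<N. a j * z ^ j\<close> of powers of a primitive \<open>N\<close>-th root of unity \<open>z\<close>, where \<open>a j\<close> is the
  sum of \<open>d\<close> along the discrete line \<open>m k + n l \<equiv> j\<close>. As \<open>N\<close> is prime, the only integer
  relations among these powers are the multiples of \<open>1 + z + \<dots> + z ^ (N - 1) = 0\<close>
  (\<open>vanishing_sum_of_roots_of_unity\<close>, from Eisenstein's criterion), so the line sums \<open>a j\<close>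
  are all equal; they add up to the coefficient at \<open>(0, 0)\<close>, which is \<open>0\<close>, so each of them is
  \<open>0\<close> (\<open>fibre_sums_vanish\<close>).

  Thus one coefficient controls all lines in a whole direction, and proportional pairs
  \<open>(k, l)\<close> give the same lines. By Thue's pigeonhole lemma (\<open>Thue\<close>) every direction modulo
  \<open>N\<close> has a representative with entries of absolute value at most \<open>\<lfloor>sqrt N\<rfloor>\<close>; this is where
  the size of the box comes from. Hence the sum of \<open>d\<close> along every line is \<open>0\<close>.

  Finally, the \<open>N + 1\<close> lines through a point of the affine plane over the field with \<open>N\<close>
  elements cover this point \<open>N + 1\<close> times and every other point once. Adding the sums over
  these lines gives \<open>N\<close> times the entry at the point plus the sum of all entries, which is
  \<open>0\<close>, so the entry is \<open>0\<close> (\<open>determined_by_line_sums\<close>).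
\<close>

section \<open>Eisenstein's criterion and minimal degree\<close>

text \<open>
  The half of Eisenstein's criterion in which \<open>p\<close> does not divide the constant term of \<open>g\<close>: the first
  coefficient of \<open>f\<close> not divisible by \<open>p\<close> then forces a coefficient of \<open>E\<close> in the same
  position not divisible by \<open>p\<close>. Only the leading position is possible, so \<open>f\<close> has
  the degree of \<open>E\<close>.
\<close>
lemma Eisenstein_constant_factor:
  fixes E f g :: "int poly" and p :: int
  assumes p: "prime p"
    and low: "\<And>i. i < degree E \<Longrightarrow> p dvd coeff E i"
    and lead: "\<not> p dvd lead_coeff E"
    and E: "E = f * g"
    and g0: "\<not> p dvd coeff g 0"
  shows "degree g = 0"
proof -
  have "E \<noteq> 0" using lead by auto
  hence nz: "f \<noteq> 0" "g \<noteq> 0" using E by auto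
  have "\<not> p dvd lead_coeff f"
    using lead by (auto simp: E lead_coeff_mult)
  hence ex: "\<exists>i. \<not> p dvd coeff f i" by blast
  define i where "i = (LEAST i. \<not> p dvd coeff f i)"
  have i: "\<not> p dvd coeff f i" unfolding i_def using LeastI_ex[OF ex] .
  have below: "p dvd coeff f j" if "j < i" for j
    using not_less_Least that unfolding i_def by blast
  have "coeff E i = (\<Sum>j\<le>i. coeff f j * coeff g (i - j))"
    by (simp add: E coeff_mult)
  also have "\<dots> = coeff f i * coeff g 0 + (\<Sum>j<i. coeff f j * coeff g (i - j))"
    by (simp add: lessThan_Suc_atMost [symmetric])
  finally have "coeff E i = coeff f i * coeff g 0 + (\<Sum>j<i. coeff f j * coeff g (i - j))" .
  moreover have "p dvd (\<Sum>j<i. coeff f j * coeff g (i - j))"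
    by (intro dvd_sum dvd_mult2 below) simp
  moreover have "\<not> p dvd coeff f i * coeff g 0"
    using p i g0 by (simp add: prime_dvd_mult_iff)
  ultimately have "\<not> p dvd coeff E i"
    by (simp add: dvd_add_left_iff)
  hence "degree E \<le> i" using low by (meson not_le)
  also have "i \<le> degree f"
    using i by (metis dvd_0_right coeff_eq_0 not_le)
  finally show ?thesis using nz by (simp add: E degree_mult_eq)
qed

lemma Eisenstein_criterion:
  fixes E f g :: "int poly" and p :: int
  assumes p: "prime p"
    and low: "\<And>i. i < degree E \<Longrightarrow> p dvd coeff E i"
    and lead: "\<not> p dvd lead_coeff E"
    and const: "\<not> p\<^sup>2 dvd coeff E 0"
    and E: "E = f * g"
  shows "degree f = 0 \<or> degree g = 0"
proof -
  have "coeff E 0 = coeff f 0 * coeff g 0" by (simp add: E coeff_mult)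
  hence "\<not> p dvd coeff f 0 \<or> \<not> p dvd coeff g 0"
    using const by (auto simp: power2_eq_square intro: mult_dvd_mono)
  thus ?thesis
    using Eisenstein_constant_factor[OF p low lead E] Eisenstein_constant_factor[OF p low lead, of g f] E
    by (auto simp: mult.commute)
qed

text \<open>
  Being irreducible, \<open>E\<close> is the minimal polynomial of its root \<open>x\<close>. To stay inside the
  integer polynomials, take an annihilating polynomial of least degree and divide out its
  content, giving \<open>h\<close>. Pseudo-division shows that \<open>h\<close> divides a multiple of \<open>E\<close>, multiplicativity
  of the content (Gauss) that it divides \<open>E\<close> itself, and Eisenstein that it has the degree of \<open>E\<close>.
\<close>
lemma Eisenstein_degree_le:
  fixes E f :: "int poly" and p :: int and x :: complex
  assumes p: "prime p"
    and low: "\<And>i. i < degree E \<Longrightarrow> p dvd coeff E i"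
    and monic: "lead_coeff E = 1"
    and const: "\<not> p\<^sup>2 dvd coeff E 0"
    and root: "poly (of_int_poly E) x = 0"
    and f: "f \<noteq> 0" "poly (of_int_poly f) x = 0"
  shows "degree E \<le> degree f"
proof -
  define P where "P = (\<lambda>h :: int poly. h \<noteq> 0 \<and> poly (of_int_poly h) x = 0)"
  have "P f" using f by (simp add: P_def)
  then obtain h0 where h0: "P h0" and min: "\<And>h. P h \<Longrightarrow> degree h0 \<le> degree h"
    using ex_has_least_nat[of P f degree] by blast
  define h where "h = primitive_part h0"
  have h_eq: "h0 = smult (content h0) h" by (simp add: h_def)
  have h0nz: "h0 \<noteq> 0" "poly (of_int_poly h0) x = 0" using h0 by (auto simp: P_def)
  have deg_h: "degree h = degree h0" by (simp add: h_def)
  have hnz: "h \<noteq> 0" using h0nz by (simp add: h_def)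
  have "of_int (content h0) * poly (of_int_poly h) x = 0"
    using h0nz(2) by (subst (asm) h_eq) (simp add: of_int_hom.map_poly_hom_smult)
  hence root_h: "poly (of_int_poly h) x = 0" using h0nz by simp
  have cont_h: "content h = 1" using h0nz by (simp add: h_def)
  obtain q r where "pseudo_divmod E h = (q, r)" by fastforce
  note div = pseudo_divmod[OF hnz this]
  let ?c = "lead_coeff h ^ (Suc (degree E) - degree h)"
  have "poly (of_int_poly (smult ?c E)) x = 0"
    using root by (simp add: of_int_hom.map_poly_hom_smult)
  hence "poly (of_int_poly r) x = 0"
    unfolding div(1) by (simp add: of_int_poly_hom.hom_add of_int_poly_hom.hom_mult root_h)
  hence "r = 0" using min[of r] div(2) deg_h by (metis P_def not_less)
  with div(1) have cE: "smult ?c E = h * q" by simp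
  \<comment> \<open>\<open>E\<close> and \<open>h\<close> are primitive, so the constant \<open>?c\<close> must be absorbed by \<open>q\<close>.\<close>
  have "content E dvd lead_coeff E" by (rule content_dvd_coeff)
  hence cont_E: "content E = 1"
    using monic by (metis content_1 normalize_content is_unit_normalize normalize_1)
  have "content (h * q) = normalize ?c"
    unfolding cE[symmetric] by (simp add: cont_E)
  hence "?c dvd content q" by (simp add: content_mult cont_h)
  then obtain q' where q': "q = smult ?c q'"
    using const_poly_dvd_iff_dvd_content[of ?c q] by (auto elim!: dvdE)
  have "smult ?c E = smult ?c (h * q')" using cE q' by simp
  hence "smult ?c (E - h * q') = 0" by (simp add: smult_diff_right)
  hence "E = h * q'" using hnz by simp
  hence dis: "degree h = 0 \<or> degree q' = 0"
    using Eisenstein_criterion[OF p low _ const, of h q'] monic p by (auto simp: prime_int_iff)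
  moreover have "degree h \<noteq> 0"
  proof
    assume "degree h = 0"
    then obtain a where "h = [:a:]" by (rule degree_eq_zeroE)
    thus False using hnz root_h by simp
  qed
  moreover have "q' \<noteq> 0" using \<open>E = h * q'\<close> monic by auto
  ultimately have "degree E = degree h"
    using \<open>E = h * q'\<close> hnz by (simp add: degree_mult_eq)
  thus ?thesis using min[OF \<open>P f\<close>] deg_h by simp
qed

section \<open>Integer relations between roots of unity of prime order\<close>

text \<open>
  The cyclotomic polynomial \<open>1 + x + \<dots> + x ^ (p - 1)\<close> becomes Eisenstein after the substitution
  of \<open>x + 1\<close> for \<open>x\<close>: the result is \<open>((x + 1) ^ p - 1) / x\<close>, whose coefficients are binomial
  coefficients. The polynomial \<open>E\<close> in the proof is this quotient, with root \<open>z - 1\<close>.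
\<close>
lemma root_of_unity_not_root_of_small_degree:
  fixes p :: nat and z :: complex and f :: "int poly"
  assumes p: "prime p" and z: "z ^ p = 1" "z \<noteq> 1"
    and f: "poly (of_int_poly f) z = 0" "degree f < p - 1"
  shows "f = 0"
proof (rule ccontr)
  assume "f \<noteq> 0"
  have p2: "p \<ge> 2" using p by (rule prime_ge_2_nat)
  define E :: "int poly" where "E = (\<Sum>k<p. monom (int (p choose Suc k)) k)"
  have coeff_E: "coeff E i = (if i < p then int (p choose Suc i) else 0)" for i
    by (simp add: E_def coeff_sum if_distrib sum.delta cong: if_cong)
  have deg_E: "degree E = p - 1"
  proof (rule antisym)
    show "degree E \<le> p - 1" by (rule degree_le) (auto simp: coeff_E)
    show "p - 1 \<le> degree E" using p2 by (intro le_degree) (simp add: coeff_E)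
  qed
  have x1: "[:1, 1 :: int:] = [:0, 1:] + 1" by (simp add: one_pCons)
  have "[:0, 1:] * E = [:1, 1:] ^ p - 1"
  proof (rule poly_eqI)
    fix i
    have "[:1, 1 :: int:] ^ p = (\<Sum>k\<le>p. monom (int (p choose k)) k)"
      using binomial_ring[of "[:0, 1:]" "1 :: int poly" p] x1
      by (simp add: monom_altdef of_nat_poly power_mult_distrib mult.commute monom_power)
    thus "coeff ([:0, 1:] * E) i = coeff ([:1, 1:] ^ p - 1) i"
      by (cases i) (auto simp: coeff_E coeff_sum if_distrib sum.delta cong: if_cong)
  qed
  hence "poly (of_int_poly ([:0, 1:] * E)) (z - 1) = poly (of_int_poly ([:1, 1:] ^ p - 1)) (z - 1)"
    by simp
  hence "(z - 1) * poly (of_int_poly E) (z - 1) = z ^ p - 1"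
    by (simp add: of_int_poly_hom.hom_mult of_int_poly_hom.hom_minus of_int_poly_hom.hom_power
        del: mult_pCons_left mult_pCons_right)
  hence root: "poly (of_int_poly E) (z - 1) = 0" using z by simp
  have "degree E \<le> degree (pcompose f [:1, 1:])"
  proof (rule Eisenstein_degree_le)
    show "prime (int p)" using p by simp
    show "int p dvd coeff E i" if "i < degree E" for i
      using that p deg_E by (auto simp: coeff_E intro!: dvd_choose_prime)
    show "lead_coeff E = 1" using p2 by (simp add: deg_E coeff_E)
    show "\<not> (int p)\<^sup>2 dvd coeff E 0"
    proof
      assume "(int p)\<^sup>2 dvd coeff E 0"
      hence "p * p dvd p * 1" using p2 by (simp add: coeff_E power2_eq_square flip: of_nat_mult)
      thus False using p2 by (subst (asm) nat_mult_dvd_cancel_disj) auto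
    qed
    show "poly (of_int_poly E) (z - 1) = 0" by fact
    show "pcompose f [:1, 1:] \<noteq> 0" using \<open>f \<noteq> 0\<close> by (simp add: pcompose_eq_0_iff)
    show "poly (of_int_poly (pcompose f [:1, 1:])) (z - 1) = 0"
      using f(1) by (simp add: of_int_hom.map_poly_pcompose poly_pcompose)
  qed
  thus False using deg_E f(2) by simp
qed

text \<open>
  Subtracting \<open>a (p - 1)\<close> times the relation \<open>\<Sum>j<p. z ^ j = 0\<close> removes the top power, and the
  remaining polynomial has too small a degree to vanish at \<open>z\<close> unless it is \<open>0\<close>.
\<close>
lemma vanishing_sum_of_roots_of_unity:
  fixes p :: nat and z :: complex and a :: "nat \<Rightarrow> int"
  assumes p: "prime p" and z: "z ^ p = 1" "z \<noteq> 1"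
    and sum0: "(\<Sum>j<p. of_int (a j) * z ^ j) = 0" and "j < p"
  shows "a j = a (p - 1)"
proof -
  have p2: "p \<ge> 2" using p by (rule prime_ge_2_nat)
  define f :: "int poly" where "f = (\<Sum>j<p - 1. monom (a j - a (p - 1)) j)"
  have coeff_f: "coeff f i = (if i < p - 1 then a i - a (p - 1) else 0)" for i
    by (simp add: f_def coeff_sum if_distrib sum.delta cong: if_cong)
  have geo: "(\<Sum>j<p. z ^ j) = 0" using z by (simp add: geometric_sum)
  have "poly (of_int_poly f) z = (\<Sum>j<p - 1. of_int (a j - a (p - 1)) * z ^ j)"
    by (simp add: f_def of_int_poly_hom.hom_sum poly_sum poly_monom)
  also have "\<dots> = (\<Sum>j<p. of_int (a j - a (p - 1)) * z ^ j)"
    using p2 by (cases p) auto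
  also have "\<dots> = (\<Sum>j<p. of_int (a j) * z ^ j) - of_int (a (p - 1)) * (\<Sum>j<p. z ^ j)"
    by (simp add: left_diff_distrib sum_subtractf sum_distrib_left)
  finally have "poly (of_int_poly f) z = 0" using sum0 geo by simp
  moreover have "degree f < p - 1"
  proof -
    have "degree f \<le> p - 2" by (rule degree_le) (auto simp: coeff_f)
    thus ?thesis using p2 by linarith
  qed
  ultimately have "f = 0" 
    using root_of_unity_not_root_of_small_degree[OF p z] by blast
  hence "coeff f j = 0" by simp
  thus ?thesis using \<open>j < p\<close> by (cases "j = p - 1") (simp_all only: coeff_f, simp_all split: if_splits)
qed

text \<open>
  Here \<open>\<phi>\<close> will be the linear form \<open>m k + n l\<close>, and its fibres modulo \<open>p\<close> are the lines in one
  direction. Grouping the exponential sum by these fibres gives an integer relation between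
  powers of one root of unity, so all fibre sums agree, and their total is \<open>0\<close>.
\<close>
lemma fibre_sums_vanish:
  fixes p :: nat and d \<phi> :: "'a \<Rightarrow> int"
  assumes p: "prime p" and "finite A"
    and dft: "(\<Sum>x\<in>A. of_int (d x) * exp (2 * of_real pi * \<i> * of_int (\<phi> x) / of_nat p)) = 0"
    and total: "(\<Sum>x\<in>A. d x) = 0"
  shows "(\<Sum>x\<in>{x\<in>A. [\<phi> x = c] (mod int p)}. d x) = 0"
proof -
  have p2: "p \<ge> 2" using p by (rule prime_ge_2_nat)
  define z where "z = exp (2 * of_real pi * \<i> / of_nat p)"
  have zp: "z ^ p = 1" using p2 by (simp add: z_def exp_of_nat_mult[symmetric])
  have z1: "z \<noteq> 1"
  proof
    assume "z = 1"
    hence "cos (2 * pi / p) = 1" by (simp add: z_def exp_eq_polar complex_eq_iff)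
    then obtain n :: int where "2 * pi / p = of_int n * 2 * pi"
      by (auto simp: cos_one_2pi_int)
    hence "of_int (int p * n) = (of_int 1 :: real)" using p2 by (simp add: field_simps)
    hence "int p * n = 1" by (simp only: of_int_eq_iff)
    thus False using p2 by (simp add: zmult_eq_1_iff)
  qed
  define r where "r = (\<lambda>x. nat (\<phi> x mod int p))"
  have r_less: "r x < p" for x using p2 by (simp add: r_def nat_less_iff)
  have exp_eq: "exp (2 * of_real pi * \<i> * of_int (\<phi> x) / of_nat p) = z ^ r x" for x
  proof -
    have "\<phi> x = int p * (\<phi> x div int p) + int (r x)" using p2 by (simp add: r_def)
    hence "(of_int (\<phi> x) :: complex) = of_nat p * of_int (\<phi> x div int p) + of_nat (r x)"
      by (metis of_int_add of_int_mult of_int_of_nat_eq)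
    hence "2 * of_real pi * \<i> * of_int (\<phi> x) / of_nat p
        = of_nat (r x) * (2 * of_real pi * \<i> / of_nat p) + \<i> * of_real (2 * pi * of_int (\<phi> x div int p))"
      using p2 by (simp add: field_simps)
    hence "exp (2 * of_real pi * \<i> * of_int (\<phi> x) / of_nat p)
        = z ^ r x * exp (\<i> * of_real (2 * pi * of_int (\<phi> x div int p)))"
      by (simp only: exp_add exp_of_nat_mult z_def)
    thus ?thesis by (simp only: cis_conv_exp[symmetric] cis_multiple_2pi[OF Ints_of_int] mult_1_right)
  qed
  define a where "a = (\<lambda>j. \<Sum>x\<in>{x\<in>A. r x = j}. d x)"
  have "(\<Sum>j<p. of_int (a j) * z ^ j)
      = (\<Sum>j<p. \<Sum>x\<in>{x\<in>A. r x = j}. of_int (d x) * z ^ r x)"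
    by (simp add: a_def sum_distrib_right)
  also have "\<dots> = (\<Sum>x\<in>A. of_int (d x) * z ^ r x)"
    using \<open>finite A\<close> r_less by (intro sum.group) auto
  also have "\<dots> = 0" using dft by (simp add: exp_eq)
  finally have eq: "a j = a (p - 1)" if "j < p" for j
    using vanishing_sum_of_roots_of_unity[OF p zp z1 _ that] by blast
  have "int p * a (p - 1) = (\<Sum>j<p. a (p - 1))" by simp
  also have "\<dots> = (\<Sum>j<p. a j)" by (intro sum.cong refl eq[symmetric]) simp
  also have "\<dots> = (\<Sum>x\<in>A. d x)"
    unfolding a_def using \<open>finite A\<close> r_less by (intro sum.group) auto
  finally have "a (p - 1) = 0" using total p2 by simp
  moreover have "nat (c mod int p) < p" using p2 by (simp add: nat_less_iff)
  ultimately have "a (nat (c mod int p)) = 0" using eq by metis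
  moreover have "r x = nat (c mod int p) \<longleftrightarrow> [\<phi> x = c] (mod int p)" for x
    using p2 by (simp add: r_def cong_def eq_nat_nat_iff)
  ultimately show ?thesis by (simp add: a_def)
qed

section \<open>Small representatives of directions\<close>

text \<open>
  The square \<open>{0..s} \<times> {0..s}\<close> with \<open>s = \<lfloor>sqrt N\<rfloor>\<close> has \<open>(s + 1)\<^sup>2 > N\<close> points, so \<open>a u - v\<close> takes
  the same residue at two of them; their difference is the required pair.
\<close>
lemma Thue:
  fixes N :: nat and a :: int
  assumes "N > 0"
  obtains x y :: int where "x \<noteq> 0 \<or> y \<noteq> 0"
    "\<bar>x\<bar> \<le> \<lfloor>sqrt (real N)\<rfloor>" "\<bar>y\<bar> \<le> \<lfloor>sqrt (real N)\<rfloor>" "[a * x = y] (mod int N)"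
proof -
  define s where "s = \<lfloor>sqrt (real N)\<rfloor>"
  have s0: "s \<ge> 0" by (simp add: s_def)
  define B where "B = {0..s} \<times> {0..s}"
  define g where "g = (\<lambda>(u, v). (a * u - v) mod int N)"
  have "sqrt (real N) < of_int (s + 1)" unfolding s_def by linarith
  hence "sqrt (real N) ^ 2 < of_int (s + 1) ^ 2" by (intro power_strict_mono) auto
  hence "of_int (int N) < (of_int ((s + 1) ^ 2) :: real)" by simp
  hence "int N < (s + 1) ^ 2" by (simp only: of_int_less_iff)
  also have "\<dots> = int (card B)" using s0 by (simp add: B_def power2_eq_square)
  finally have "card {0..<int N} < card B" by simp
  moreover have "g ` B \<subseteq> {0..<int N}" using assms by (auto simp: g_def)
  hence "card (g ` B) \<le> card {0..<int N}" by (intro card_mono) auto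
  ultimately have "\<not> inj_on g B" by (intro pigeonhole) linarith
  then obtain u v u' v' where uv: "(u, v) \<in> B" "(u', v') \<in> B" "(u, v) \<noteq> (u', v')"
      "g (u, v) = g (u', v')" unfolding inj_on_def by auto
  show thesis
  proof (rule that[of "u - u'" "v - v'"])
    show "u - u' \<noteq> 0 \<or> v - v' \<noteq> 0" using uv(3) by auto
    show "\<bar>u - u'\<bar> \<le> \<lfloor>sqrt (real N)\<rfloor>" "\<bar>v - v'\<bar> \<le> \<lfloor>sqrt (real N)\<rfloor>"
      using uv(1,2) by (auto simp: B_def s_def)
    have "int N dvd (a * u - v) - (a * u' - v')"
      using uv(4) by (simp add: g_def mod_eq_dvd_iff)
    thus "[a * (u - u') = v - v'] (mod int N)"
      by (simp add: cong_iff_dvd_diff algebra_simps)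
  qed
qed

section \<open>Recovering a function from its line sums\<close>

text \<open>
  Add up the sums over the lines through \<open>(m, n)\<close>. As \<open>N\<close> is prime, any other point lies on exactly
  one of them: on the one with constant second coordinate if it shares \<open>n\<close>, and
  otherwise on the one whose slope \<open>a\<close> solves a linear congruence with invertible coefficient.
  The set \<open>hit x\<close> in the proof collects the slopes of the lines that pass through \<open>x\<close>.
\<close>
lemma determined_by_line_sums:
  fixes N :: nat and d :: "nat \<times> nat \<Rightarrow> int"
  defines "A \<equiv> {1..N} \<times> {1..N}"
  assumes p: "prime N" and total: "(\<Sum>x\<in>A. d x) = 0"
    and lines: "\<And>a c. (\<Sum>x\<in>{x\<in>A. [int (fst x) + int (snd x) * a = c] (mod int N)}. d x) = 0"
    and constant_snd: "\<And>c. (\<Sum>x\<in>{x\<in>A. [int (snd x) = c] (mod int N)}. d x) = 0"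
    and "(m, n) \<in> A"
  shows "d (m, n) = 0"
proof -
  have fin: "finite A" by (simp add: A_def)
  have N0: "N > 0" using p prime_gt_0_nat by blast
  define hit where "hit = (\<lambda>x. {a \<in> {0..<int N}. [int (fst x) + int (snd x) * a = int m + int n * a] (mod int N)})"
  have cong_eq: "[int i = int j] (mod int N) \<longleftrightarrow> i = j" if "i \<in> {1..N}" "j \<in> {1..N}" for i j
  proof
    assume "[int i = int j] (mod int N)"
    hence "int N dvd int i - int j" by (simp add: cong_iff_dvd_diff)
    thus "i = j" using that dvd_imp_le_int[of "int i - int j" "int N"] by force
  qed simp
  have count: "int (card (hit x)) + (if [int (snd x) = int n] (mod int N) then 1 else 0)
      = 1 + (if x = (m, n) then int N else 0)" if "x \<in> A" for x
  proof -
    obtain i j where x: "x = (i, j)" by (cases x)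
    have ij: "i \<in> {1..N}" "j \<in> {1..N}" "m \<in> {1..N}" "n \<in> {1..N}"
      using that \<open>(m, n) \<in> A\<close> by (auto simp: A_def x)
    show ?thesis
    proof (cases "j = n")
      case True
      have "hit x = (if i = m then {0..<int N} else {})"
        using cong_eq[OF ij(1,3)] True by (auto simp: hit_def x cong_add_rcancel)
      thus ?thesis using True x by simp
    next
      case False
      have "\<not> int N dvd int j - int n"
        using cong_eq[OF ij(2,4)] False by (simp add: cong_iff_dvd_diff)
      hence cop: "coprime (int j - int n) (int N)"
        using p by (metis coprime_commute prime_imp_coprime prime_nat_int_transfer)
      have iff: "[int i + int j * a = int m + int n * a] (mod int N) \<longleftrightarrow> [(int j - int n) * a = int m - int i] (mod int N)" for a
        by (simp add: cong_iff_dvd_diff algebra_simps)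
      obtain b where "[(int j - int n) * b = int m - int i] (mod int N)"
        using cong_solve_dvd_int[of "int j - int n" "int N"] cop by (auto simp: coprime_iff_gcd_eq_1)
      hence iff': "[(int j - int n) * a = int m - int i] (mod int N) \<longleftrightarrow> [a = b] (mod int N)" for a
        using cop by (metis cong_mult_lcancel cong_sym cong_trans)
      have "hit x = {b mod int N}"
        unfolding hit_def x fst_conv snd_conv iff iff' using N0 by (auto simp: cong_def)
      thus ?thesis using False cong_eq[OF ij(2,4)] x by simp
    qed
  qed
  have "0 = (\<Sum>a\<in>{0..<int N}. \<Sum>x\<in>{x\<in>A. [int (fst x) + int (snd x) * a = int m + int n * a] (mod int N)}. d x)
      + (\<Sum>x\<in>{x\<in>A. [int (snd x) = int n] (mod int N)}. d x)"
    by (simp add: lines constant_snd)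
  also have "\<dots> = (\<Sum>x\<in>A. \<Sum>a\<in>hit x. d x) + (\<Sum>x\<in>A. if [int (snd x) = int n] (mod int N) then d x else 0)"
    unfolding hit_def using fin by (subst sum.swap_restrict) (auto simp: sum.inter_filter)
  also have "\<dots> = (\<Sum>x\<in>A. d x * (int (card (hit x)) + (if [int (snd x) = int n] (mod int N) then 1 else 0)))"
    by (simp add: sum.distrib[symmetric] distrib_left mult.commute if_distrib cong: if_cong)
  also have "\<dots> = (\<Sum>x\<in>A. d x + (if x = (m, n) then int N * d x else 0))"
    by (intro sum.cong) (auto simp: count algebra_simps)
  also have "\<dots> = int N * d (m, n)"
    using fin \<open>(m, n) \<in> A\<close> by (simp add: sum.distrib total)
  finally show ?thesis using N0 by simp
qed

section \<open>Determination by low-frequency coefficients\<close>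

theorem theorem7:
  fixes N :: nat and L :: int and X Y :: "complex mat"
  assumes "prime N"
    and "L \<ge> \<lfloor>sqrt (real N)\<rfloor>"
    and "X \<in> carrier_mat N N" and "binary_mat X"
    and "Y \<in> carrier_mat N N" and "binary_mat Y"
    and "\<And>k l :: int. \<bar>k\<bar> \<le> L \<Longrightarrow> \<bar>l\<bar> \<le> L \<Longrightarrow> dft2 N X k l = dft2 N Y k l"
  shows "X = Y"
proof -
  have N2: "N \<ge> 2" using assms(1) by (rule prime_ge_2_nat)
  have s1: "\<lfloor>sqrt (real N)\<rfloor> \<ge> 1" using N2 by simp
  have sN: "\<lfloor>sqrt (real N)\<rfloor> < int N"
  proof -
    have "sqrt (real N) < sqrt (real N ^ 2)" using N2 by (subst real_sqrt_less_iff) (simp add: power2_eq_square)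
    thus ?thesis by (simp add: floor_less_iff)
  qed
  define A where "A = {1..N} \<times> {1..N}"
  \<comment> \<open>\<open>d\<close> has integer values, as the arithmetic of line sums requires; the entries are
    \<open>0\<close> or \<open>1\<close>, so that taking the floor loses nothing.\<close>
  define d where "d = (\<lambda>(m, n). \<lfloor>Re (X $$ (m - 1, n - 1))\<rfloor> - \<lfloor>Re (Y $$ (m - 1, n - 1))\<rfloor>)"
  have entry: "Z $$ (m - 1, n - 1) \<in> {0, 1}"
    if "Z \<in> carrier_mat N N" "binary_mat Z" "(m, n) \<in> A" for Z :: "complex mat" and m n
  proof -
    have "Z $$ (m - 1, n - 1) \<in> elements_mat Z"
      using that by (intro elements_matI) (auto simp: A_def)
    thus ?thesis using that(2) by (auto simp: binary_mat_def)
  qed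
  have d: "of_int (d (m, n)) = X $$ (m - 1, n - 1) - Y $$ (m - 1, n - 1)" if "(m, n) \<in> A" for m n
    using entry[OF assms(3,4) that] entry[OF assms(5,6) that] by (auto simp: d_def)
  have dft: "(\<Sum>x\<in>A. of_int (d x) * exp (2 * of_real pi * \<i> * of_int (int (fst x) * k + int (snd x) * l) / of_nat N)) = 0"
    if "\<bar>k\<bar> \<le> L" "\<bar>l\<bar> \<le> L" for k l
  proof -
    have "(\<Sum>x\<in>A. of_int (d x) * exp (2 * of_real pi * \<i> * of_int (int (fst x) * k + int (snd x) * l) / of_nat N))
      = (\<Sum>(m, n)\<in>A. (X $$ (m - 1, n - 1) - Y $$ (m - 1, n - 1)) * exp (2 * of_real pi * \<i> * of_int (int m * k + int n * l) / of_nat N))"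
      by (intro sum.cong) (auto simp: d)
    also have "\<dots> = dft2 N X k l - dft2 N Y k l"
      by (simp add: A_def dft2_def sum.cartesian_product[symmetric] left_diff_distrib sum_subtractf)
    finally show ?thesis using assms(7)[OF that] by simp
  qed
  have "of_int (\<Sum>x\<in>A. d x) = (0 :: complex)" using dft[of 0 0] s1 assms(2) by simp
  hence total: "(\<Sum>x\<in>A. d x) = 0" by (simp only: of_int_eq_0_iff)
  have line: "(\<Sum>x\<in>{x\<in>A. [int (fst x) * k + int (snd x) * l = c] (mod int N)}. d x) = 0"
    if "\<bar>k\<bar> \<le> L" "\<bar>l\<bar> \<le> L" for k l c
    using dft[OF that] total assms(1) by (intro fibre_sums_vanish) (auto simp: A_def)
  have "(\<Sum>x\<in>{x\<in>A. [int (fst x) + int (snd x) * a = c] (mod int N)}. d x) = 0" for a c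
  proof -
    obtain x y where xy: "x \<noteq> 0 \<or> y \<noteq> 0" "\<bar>x\<bar> \<le> \<lfloor>sqrt (real N)\<rfloor>"
      "\<bar>y\<bar> \<le> \<lfloor>sqrt (real N)\<rfloor>" "[a * x = y] (mod int N)"
      using Thue[of N a] N2 by auto
    \<comment> \<open>The direction \<open>(x, y)\<close> is proportional to \<open>(1, a)\<close> once \<open>x\<close> is invertible modulo \<open>N\<close>;
      this holds because both entries are smaller than \<open>N\<close> in absolute value and not both are \<open>0\<close>.\<close>
    have "x \<noteq> 0"
    proof
      assume "x = 0"
      hence "int N dvd y" using xy(4) by (simp add: cong_iff_dvd_diff)
      thus False using \<open>x = 0\<close> xy sN dvd_imp_le_int[of y "int N"] by simp
    qed
    hence "\<not> int N dvd x" using xy(2) sN dvd_imp_le_int[of x "int N"] by auto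
    hence cop: "coprime x (int N)"
      using assms(1) by (metis coprime_commute prime_imp_coprime prime_nat_int_transfer)
    have "[int i + int j * a = c] (mod int N) \<longleftrightarrow> [int i * x + int j * y = c * x] (mod int N)" for i j
    proof -
      have "[int i + int j * a = c] (mod int N) \<longleftrightarrow> [(int i + int j * a) * x = c * x] (mod int N)"
        using cop by (simp add: cong_mult_rcancel)
      moreover have "[(int i + int j * a) * x = int i * x + int j * y] (mod int N)"
        using cong_add[OF cong_refl[of "int i * x"] cong_mult[OF cong_refl[of "int j"] xy(4)]]
        by (simp add: algebra_simps)
      ultimately show ?thesis by (meson cong_sym cong_trans)
    qed
    thus ?thesis using line[of x y "c * x"] xy assms(2) by simp
  qed
  moreover have "(\<Sum>x\<in>{x\<in>A. [int (snd x) = c] (mod int N)}. d x) = 0" for c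
    using line[of 0 1 c] s1 assms(2) by simp
  ultimately have zero: "d (m, n) = 0" if "(m, n) \<in> A" for m n
    using determined_by_line_sums[of N d] assms(1) total that unfolding A_def by blast
  show ?thesis
  proof (rule eq_matI)
    fix i j assume "i < dim_row Y" "j < dim_col Y"
    hence "(Suc i, Suc j) \<in> A" using assms(5) by (auto simp: A_def)
    from d[OF this] zero[OF this] show "X $$ (i, j) = Y $$ (i, j)" by simp
  qed (use assms(3,5) in auto)
qed

end
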